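(* Let $f(x)$ be a non-zero polynomial with real coefficients. Let $V(f)$ be the number of sign changes in the list of coefficients of $f$, and let $Z_{+}(f)$ be the number of positive real roots of $f$ counted according to their multiplicity. Then $V(f) - Z_{+}(f)$ is even and non-negative.
   Context: If $a_0, \ldots, a_n$ is a list of real numbers, the number of sign changes in it, written $V(a_0, \ldots, a_n)$, is the number of pairs of indices $(p, q)$ such that $p < q$, $a_p a_q < 0$ and $a_i = 0$ for all $p < i < q$. If $f(x) = a_0 + a_1 x + \ldots + a_n x^n$ is a polynomial with real coefficients, $V(f)$ denotes $V(a_0, \ldots, a_n)$. If $f(x)$ is a non-zero polynomial with real coefficients, $Z_{+}(f)$ denotes the sum, over all positive real numbers $c$ such that $f(c) = 0$, of the largest integer $m(c)$ such that $(c - x)^{m(c)}$ divides $f(x)$. *)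

theory Defs
  imports Complex_Main "HOL-Computational_Algebra.Polynomial"
begin

definition sign_changes :: "real list \<Rightarrow> nat" where
  "sign_changes as = card {(p, q). p < q \<and> q < length as \<and> as ! p * as ! q < 0 \<and>
     (\<forall>i. p < i \<and> i < q \<longrightarrow> as ! i = 0)}"

definition coeff_sign_changes :: "real poly \<Rightarrow> nat" where
  "coeff_sign_changes f = sign_changes (coeffs f)"

definition positive_root_count :: "real poly \<Rightarrow> nat" where
  "positive_root_count f = (\<Sum>c | c > 0 \<and> poly f c = 0. order c f)"

text \<open>The library's order of vanishing at \<open>c\<close>, phrased with powers of \<open>x - c\<close>, is the largest
  exponent \<open>m\<close> for which \<open>(c - x)\<^sup>m\<close> divides \<open>f\<close>.\<close>

lemma order_eq_Greatest:
  fixes f :: "real poly"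
  assumes "f \<noteq> 0"
  shows "order c f = (GREATEST m. [:c, -1:] ^ m dvd f)"
proof -
  have "[:c, -1:] ^ m dvd f \<longleftrightarrow> m \<le> order c f" for m
  proof -
    have "[:c, -1:] = - [:-c, 1:]"
      by simp
    then have "[:c, -1:] ^ m = (-1) ^ m * [:-c, 1:] ^ m"
      by (metis power_minus)
    then have "[:c, -1:] ^ m dvd f \<longleftrightarrow> [:-c, 1:] ^ m dvd f"
      by (cases "even m") simp_all
    with assms show ?thesis
      by (simp add: order_divides)
  qed
  then show ?thesis
    by (intro Greatest_equality [symmetric]) auto
qed

end

(* Dividing f by c - x for a positive root c lowers the number of sign changes by an odd positive
   number and the number of positive roots by one.  Once no positive root is left, the lowest
   non-zero and the leading coefficient have the same sign by the intermediate value theorem, so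
   the number of sign changes is even. *)
theory Submission
  imports Defs
begin

section \<open>Counting sign changes recursively\<close>

fun first_nonzero :: "real list \<Rightarrow> real" where
  "first_nonzero [] = 0"
| "first_nonzero (x # xs) = (if x = 0 then first_nonzero xs else x)"

text \<open>\<open>s\<close> is the last non-zero entry read so far. The value 0 means that none has
  been read; the first non-zero entry then counts no change.\<close>

fun sign_changes_from :: "real \<Rightarrow> real list \<Rightarrow> nat" where
  "sign_changes_from s [] = 0"
| "sign_changes_from s (x # xs) =
     (if x = 0 then sign_changes_from s xs else of_bool (s * x < 0) + sign_changes_from x xs)"

text \<open>Only the position of the first non-zero entry can qualify. This counts the sign changes
  whose left member is a head \<open>x\<close> put in front of \<open>xs\<close>.\<close>

lemma card_first_opposite_sign:
  "card {q. q < length xs \<and> x * xs ! q < 0 \<and> (\<forall>i<q. xs ! i = 0)} =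
     of_bool (x * first_nonzero xs < 0)"
proof (induction xs)
  case (Cons y ys)
  let ?A = "\<lambda>zs. {q. q < length zs \<and> x * zs ! q < 0 \<and> (\<forall>i<q. zs ! i = 0)}"
  show ?case
  proof (cases "y = 0")
    case True
    have "q \<in> ?A (y # ys) \<longleftrightarrow> q \<in> Suc ` ?A ys" for q
      using True by (cases q) (auto simp: All_less_Suc2)
    then have "?A (y # ys) = Suc ` ?A ys"
      by blast
    then show ?thesis
      using Cons True by (simp add: card_image)
  next
    case False
    have "q \<in> ?A (y # ys) \<longleftrightarrow> q = 0 \<and> x * y < 0" for q
      using False by (cases q) (auto simp: All_less_Suc2)
    then have "?A (y # ys) = (if x * y < 0 then {0} else {})"
      by auto
    then show ?thesis
      using False by simp
  qed
qed simp

lemma sign_changes_Nil: "sign_changes [] = 0"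
  by (simp add: sign_changes_def)

lemma sign_changes_Cons:
  "sign_changes (x # xs) = of_bool (x * first_nonzero xs < 0) + sign_changes xs"
proof -
  let ?S = "\<lambda>zs :: real list. {(p, q). p < q \<and> q < length zs \<and> zs ! p * zs ! q < 0 \<and>
    (\<forall>i. p < i \<and> i < q \<longrightarrow> zs ! i = 0)}"
  let ?A = "{q. q < length xs \<and> x * xs ! q < 0 \<and> (\<forall>i<q. xs ! i = 0)}"
  \<comment> \<open>Pairs with p = 0 start at the new head; all others are pairs of
    \<open>xs\<close> with both indices shifted by one.\<close>
  have "(p, q) \<in> ?S (x # xs) \<longleftrightarrow>
      (p, q) \<in> (\<lambda>q. (0, Suc q)) ` ?A \<union> map_prod Suc Suc ` ?S xs" for p q
  proof (cases q)
    case (Suc q')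
    have all_Suc: "(\<forall>i. P i) \<longleftrightarrow> P 0 \<and> (\<forall>i. P (Suc i))" for P :: "nat \<Rightarrow> bool"
      by (metis nat.exhaust)
    have gap: "(\<forall>i. p' < i \<and> i < Suc m \<longrightarrow> (x # xs) ! i = 0) \<longleftrightarrow>
        (\<forall>i. p' \<le> i \<and> i < m \<longrightarrow> xs ! i = 0)" for p' m
      by (subst all_Suc) (auto simp: less_Suc_eq_le)
    have "(p, q) \<in> ?S (x # xs) \<longleftrightarrow> p < q \<and> q < length (x # xs) \<and> (x # xs) ! p * (x # xs) ! q < 0 \<and>
        (\<forall>i. p \<le> i \<and> i < q' \<longrightarrow> xs ! i = 0)"
      by (simp only: mem_Collect_eq case_prod_conv Suc gap)
    also have "\<dots> \<longleftrightarrow> (p, q) \<in> (\<lambda>q. (0, Suc q)) ` ?A \<union> map_prod Suc Suc ` ?S xs"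
      using Suc by (cases p) (auto simp: Suc_le_eq image_iff)
    finally show ?thesis .
  qed auto
  then have split: "?S (x # xs) = (\<lambda>q. (0, Suc q)) ` ?A \<union> map_prod Suc Suc ` ?S xs"
    by (auto simp only: set_eq_iff split_paired_all)
  have "finite (?S xs)"
    by (rule finite_subset[of _ "{..<length xs} \<times> {..<length xs}"]) auto
  moreover have "card ((\<lambda>q. (0 :: nat, Suc q)) ` ?A) = card ?A"
    by (intro card_image inj_onI) simp
  moreover have "card (map_prod Suc Suc ` ?S xs) = card (?S xs)"
    by (intro card_image inj_onI) (auto simp: map_prod_def split: prod.splits)
  moreover have "(\<lambda>q. (0, Suc q)) ` ?A \<inter> map_prod Suc Suc ` ?S xs = {}"
    by auto
  ultimately have "card (?S (x # xs)) = card ?A + card (?S xs)"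
    unfolding split by (subst card_Un_disjoint) auto
  then show ?thesis
    by (simp add: sign_changes_def card_first_opposite_sign)
qed

lemma sign_changes_from_eq:
  "sign_changes_from s xs = of_bool (s * first_nonzero xs < 0) + sign_changes xs"
  by (induction xs arbitrary: s) (simp_all add: sign_changes_Nil sign_changes_Cons)

lemma sign_changes_eq_from: "sign_changes xs = sign_changes_from 0 xs"
  by (simp add: sign_changes_from_eq)

text \<open>Each counted change flips the sign of the last non-zero entry read, so the parity
  compares the sign at the start with the sign at the end.\<close>

lemma even_sign_changes_from:
  assumes "s \<noteq> 0" "last (s # xs) \<noteq> 0"
  shows "even (sign_changes_from s xs) \<longleftrightarrow> s * last (s # xs) > 0"
  using assms
proof (induction xs arbitrary: s)
  case Nil
  then show ?case
    by (simp add: zero_less_mult_iff) linarith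
next
  case (Cons x xs)
  show ?case
  proof (cases "x = 0")
    case True
    then show ?thesis
      using Cons.prems Cons.IH[of s] by (cases "xs = []") auto
  next
    case False
    then show ?thesis
      using Cons.prems Cons.IH[of x] by (auto simp: zero_less_mult_iff mult_less_0_iff)
  qed
qed

section \<open>Multiplication by \<open>c - x\<close>\<close>

text \<open>The argument \<open>p\<close> is the coefficient preceding the given list.\<close>

fun mult_root_factor :: "real \<Rightarrow> real \<Rightarrow> real list \<Rightarrow> real list" where
  "mult_root_factor c p [] = [- p]"
| "mult_root_factor c p (a # as) = (c * a - p) # mult_root_factor c a as"

lemma last_mult_root_factor: "last (mult_root_factor c p as) = - last (p # as)"
proof (induction as arbitrary: p)
  case (Cons a as)
  have "mult_root_factor c a as \<noteq> []"
    by (cases as) auto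
  then show ?case
    using Cons by simp
qed simp

text \<open>The preceding coefficient carries \<open>- p\<close> into the constant term;
  \<open>p = 0\<close> gives the product itself.\<close>

lemma Poly_mult_root_factor: "Poly (mult_root_factor c p as) = [:c, -1:] * Poly as - [:p:]"
  by (induction as arbitrary: p) simp_all

lemma coeffs_mult_root_factor:
  assumes "g \<noteq> 0"
  shows "coeffs ([:c, -1:] * g) = mult_root_factor c 0 (coeffs g)"
proof -
  \<comment> \<open>A non-zero last entry leaves no trailing zeros to strip, so
    \<open>coeffs\<close> recovers the list from its \<open>Poly\<close>.\<close>
  have "last (mult_root_factor c 0 (coeffs g)) \<noteq> 0"
    using assms last_coeffs_eq_coeff_degree[of g] by (simp add: last_mult_root_factor)
  then have "coeffs (Poly (mult_root_factor c 0 (coeffs g))) = mult_root_factor c 0 (coeffs g)"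
    by (auto simp: coeffs_Poly strip_while_idem_iff no_trailing_unfold)
  then show ?thesis
    by (simp add: Poly_mult_root_factor)
qed

text \<open>Here \<open>s\<close> and \<open>r\<close> are the last non-zero coefficients read before the given lists in the
  product and in the factor.  If the preceding coefficient \<open>p\<close> vanishes, then the product has
  a coefficient \<open>- r\<close> at the place following \<open>r\<close>, so \<open>s\<close> and \<open>r\<close> have opposite signs.\<close>

lemma sign_changes_from_mult_root_factor:
  assumes "c > 0" "s \<noteq> 0" "r \<noteq> 0" "p = r \<or> p = 0 \<and> s * r < 0" "last (p # as) \<noteq> 0"
  shows "\<exists>k. sign_changes_from s (mult_root_factor c p as) =
    sign_changes_from r as + of_bool (s * r > 0) + 2 * k"
  using assms(2-)
proof (induction as arbitrary: s r p)
  case Nil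
  then show ?case
    by (auto simp: zero_less_mult_iff mult_less_0_iff)
next
  case (Cons a as)
  define b where "b = c * a - p"
  define s' where "s' = (if b = 0 then s else b)"
  define r' where "r' = (if a = 0 then r else a)"
  \<comment> \<open>Here \<open>c * a\<close> and \<open>- p\<close> cannot cancel, which fixes the
    sign of the next product coefficient \<open>b\<close>.\<close>
  have b_pos: "b > 0" if "a \<ge> 0" "p \<le> 0" "a \<noteq> 0 \<or> p \<noteq> 0"
  proof (cases "a = 0")
    case False
    then have "c * a > 0"
      using that \<open>c > 0\<close> by (intro mult_pos_pos) auto
    then show ?thesis
      using that unfolding b_def by linarith
  qed (use that in \<open>auto simp: b_def\<close>)
  have b_neg: "b < 0" if "a \<le> 0" "p \<ge> 0" "a \<noteq> 0 \<or> p \<noteq> 0"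
  proof (cases "a = 0")
    case False
    then have "c * a < 0"
      using that \<open>c > 0\<close> by (intro mult_pos_neg) auto
    then show ?thesis
      using that unfolding b_def by linarith
  qed (use that in \<open>auto simp: b_def\<close>)
  have b_zero: "b = 0" if "a = 0" "p = 0"
    using that by (simp add: b_def)
  \<comment> \<open>If \<open>a = 0\<close>, then \<open>b = - p\<close>: either
    \<open>p = r\<close>, so \<open>s' = - r\<close> and \<open>r' = r\<close>, or
    \<open>p = 0\<close> and both \<open>s\<close> and \<open>r\<close> persist.\<close>
  have "a = r' \<or> a = 0 \<and> s' * r' < 0"
    using Cons.prems b_pos b_neg b_zero unfolding s'_def r'_def
    by (cases r "0 :: real" rule: linorder_cases; cases s "0 :: real" rule: linorder_cases)
      (auto simp: mult_less_0_iff)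
  moreover have "s' \<noteq> 0" "r' \<noteq> 0" "last (a # as) \<noteq> 0"
    using Cons.prems by (auto simp: s'_def r'_def)
  ultimately obtain k where k: "sign_changes_from s' (mult_root_factor c a as) =
      sign_changes_from r' as + of_bool (s' * r' > 0) + 2 * k"
    using Cons.IH by blast
  \<comment> \<open>Both sums are odd iff \<open>s * r' > 0\<close>. The left one could be smaller
    only as 0 against 2: then \<open>p = r\<close>, and \<open>a\<close> has the sign opposite to
    \<open>r\<close>, so \<open>b\<close> has it too, whereas \<open>s'\<close> would need the sign
    of \<open>r\<close>.\<close>
  have "\<exists>j :: nat. of_bool (s * s' < 0) + of_bool (s' * r' > 0) =
      of_bool (r * r' < 0) + of_bool (s * r > 0) + 2 * j"
  proof -
    have "of_bool (s * s' < 0) + of_bool (s' * r' > 0) =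
        of_bool (r * r' < 0) + of_bool (s * r > 0) + 2 * (0 :: nat) \<or>
      of_bool (s * s' < 0) + of_bool (s' * r' > 0) =
        of_bool (r * r' < 0) + of_bool (s * r > 0) + 2 * (1 :: nat)"
      using Cons.prems(1-3) b_pos b_neg b_zero
      unfolding s'_def r'_def mult_less_0_iff zero_less_mult_iff
      by (cases a "0 :: real" rule: linorder_cases; cases b "0 :: real" rule: linorder_cases;
          cases s "0 :: real" rule: linorder_cases; cases r "0 :: real" rule: linorder_cases) auto
    then show ?thesis
      by blast
  qed
  then obtain j :: nat where j: "of_bool (s * s' < 0) + of_bool (s' * r' > 0) =
      of_bool (r * r' < 0) + of_bool (s * r > 0) + 2 * j"
    by blast
  have "sign_changes_from s (mult_root_factor c p (a # as)) =
      of_bool (s * s' < 0) + sign_changes_from s' (mult_root_factor c a as)"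
    by (auto simp: s'_def b_def mult_less_0_iff)
  also have "\<dots> = (of_bool (s * s' < 0) + of_bool (s' * r' > 0)) + sign_changes_from r' as + 2 * k"
    by (simp only: k ac_simps)
  also have "\<dots> =
      (of_bool (r * r' < 0) + sign_changes_from r' as) + of_bool (s * r > 0) + 2 * (j + k)"
    unfolding j by simp
  also have "of_bool (r * r' < 0) + sign_changes_from r' as = sign_changes_from r (a # as)"
    by (auto simp: r'_def mult_less_0_iff)
  finally show ?case
    by blast
qed

text \<open>Initial zeros of \<open>as\<close> become initial zeros of the product. At the first
  non-zero \<open>a\<close> the product has \<open>c * a\<close>, of the same sign, and this
  agreement supplies the extra 1.\<close>

lemma sign_changes_mult_root_factor:
  assumes "c > 0" "as \<noteq> []" "last as \<noteq> 0"
  shows "\<exists>k. sign_changes (mult_root_factor c 0 as) = sign_changes as + 1 + 2 * k"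
  using assms(2-)
proof (induction as)
  case (Cons a as)
  show ?case
  proof (cases "a = 0")
    case True
    then show ?thesis
      using Cons by (cases "as = []") (auto simp: sign_changes_eq_from)
  next
    case False
    then have "c * a * a > 0"
      using \<open>c > 0\<close> by (cases a "0 :: real" rule: linorder_cases) (auto simp: zero_less_mult_iff mult_less_0_iff)
    then show ?thesis
      using False Cons.prems \<open>c > 0\<close> sign_changes_from_mult_root_factor[of c "c * a" a a as]
      by (simp add: sign_changes_eq_from)
  qed
qed simp

lemma coeff_sign_changes_mult_root_factor:
  assumes "c > 0" "g \<noteq> 0"
  shows "\<exists>k. coeff_sign_changes ([:c, -1:] * g) = coeff_sign_changes g + 1 + 2 * k"
  using assms sign_changes_mult_root_factor[of c "coeffs g"] last_coeffs_eq_coeff_degree[of g]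
  by (simp add: coeff_sign_changes_def coeffs_mult_root_factor del: mult_pCons_left)

lemma positive_root_count_mult_root_factor:
  assumes "c > 0" "g \<noteq> 0"
  shows "positive_root_count ([:c, -1:] * g) = positive_root_count g + 1"
proof -
  let ?f = "[:c, -1:] * g"
  let ?R = "{x. x > 0 \<and> poly ?f x = 0}"
  have f: "?f \<noteq> 0"
    using assms by (simp del: mult_pCons_left)
  have fin: "finite ?R"
    by (rule finite_subset[OF _ poly_roots_finite[OF f]]) auto
  have linear: "order x [:c, -1:] = of_bool (x = c)" for x
  proof (cases "x = c")
    case True
    \<comment> \<open>Negation does not affect the order, which reduces the claim to the monic
      factor.\<close>
    have "order c (- [:-c, 1:]) = 1"
      unfolding order_uminus using order_power_n_n[of c 1] by simp
    then show ?thesis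
      using True by simp
  qed (simp add: order_0I)
  have "positive_root_count ?f = (\<Sum>x\<in>?R. of_bool (x = c) + order x g)"
    unfolding positive_root_count_def by (simp only: order_mult[OF f] linear)
  also have "\<dots> = (\<Sum>x\<in>?R. of_bool (x = c)) + (\<Sum>x\<in>?R. order x g)"
    by (rule sum.distrib)
  also have "(\<Sum>x\<in>?R. of_bool (x = c)) = (1 :: nat)"
    using assms fin by (simp add: of_bool_def sum.delta)
  \<comment> \<open>The point \<open>c\<close> may fail to be a root of \<open>g\<close>, but then
    its order there is 0.\<close>
  also have "(\<Sum>x\<in>?R. order x g) = positive_root_count g"
    unfolding positive_root_count_def using fin
    by (intro sum.mono_neutral_right) (auto simp: order_0I)
  finally show ?thesis
    by simp
qed

section \<open>Polynomials without positive roots\<close>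

lemma poly_positive_root_if_opposite_signs:
  fixes g :: "real poly"
  assumes "poly g 0 * lead_coeff g < 0"
  obtains x where "x > 0" "poly g x = 0"
proof -
  have *: "\<exists>x>0. poly h x = 0" if "poly h 0 < 0" "lead_coeff h > 0" for h :: "real poly"
  proof -
    obtain n where n: "\<forall>x\<ge>n. lead_coeff h \<le> poly h x"
      using poly_pinfty_gt_lc \<open>lead_coeff h > 0\<close> by blast
    \<comment> \<open>The maximum with 1 keeps the point to the right of 0 even if \<open>n\<close>
      is negative.\<close>
    then have "poly h (max n 1) > 0"
      using \<open>lead_coeff h > 0\<close> by (meson less_le_trans max.cobounded1)
    moreover have "0 < max n 1"
      by simp
    ultimately show ?thesis
      using poly_IVT_pos \<open>poly h 0 < 0\<close> by blast
  qed
  show ?thesis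
    using assms *[of g] *[of "- g"] that by (auto simp: mult_less_0_iff)
qed

lemma even_coeff_sign_changes:
  assumes "g \<noteq> 0" "\<And>x. x > 0 \<Longrightarrow> poly g x \<noteq> 0"
  shows "even (coeff_sign_changes g)"
  using assms
proof (induction g rule: pCons_induct)
  case (pCons a h)
  have coeffs: "coeffs (pCons a h) = a # coeffs h"
    using pCons.hyps by (auto simp: cCons_def)
  then have changes: "coeff_sign_changes (pCons a h) = sign_changes_from 0 (a # coeffs h)"
    by (simp only: coeff_sign_changes_def sign_changes_eq_from)
  show ?case
  proof (cases "a = 0")
    case True
    \<comment> \<open>Removing a factor x changes neither the positive roots nor the sign
      changes.\<close>
    then have "even (coeff_sign_changes h)"
      using pCons by simp
    then show ?thesis
      unfolding changes using True by (simp add: coeff_sign_changes_def sign_changes_eq_from)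
  next
    case False
    have last: "last (a # coeffs h) = lead_coeff (pCons a h)"
      using last_coeffs_eq_coeff_degree[OF pCons.prems(1)] by (simp only: coeffs)
    have nz: "lead_coeff (pCons a h) \<noteq> 0"
      using pCons.prems(1) by (simp only: leading_coeff_0_iff not_False_eq_True)
    have "\<not> a * lead_coeff (pCons a h) < 0"
      using poly_positive_root_if_opposite_signs[of "pCons a h"] pCons.prems(2)
      by (metis poly_0_coeff_0 coeff_pCons_0)
    then have "a * lead_coeff (pCons a h) > 0"
      using nz False by (metis linorder_neqE_linordered_idom mult_eq_0_iff)
    then have "even (sign_changes_from a (coeffs h))"
      using even_sign_changes_from[of a "coeffs h"] False nz unfolding last by blast
    then show ?thesis
      unfolding changes using False by simp
  qed
qed simp

section \<open>Descartes' rule of signs\<close>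

text \<open>A natural number \<open>k\<close> records evenness and non-negativity of the difference
  at once.\<close>

lemma coeff_sign_changes_eq_positive_root_count:
  assumes "f \<noteq> 0"
  shows "\<exists>k. coeff_sign_changes f = positive_root_count f + 2 * k"
  using assms
proof (induction "degree f" arbitrary: f rule: less_induct)
  case less
  show ?case
  proof (cases "\<exists>c>0. poly f c = 0")
    case True
    then obtain c where c: "c > 0" "poly f c = 0"
      by blast
    then obtain h where "f = [:-c, 1:] * h"
      using poly_eq_0_iff_dvd by blast
    then have f: "f = [:c, -1:] * (- h)"
      by simp
    define g where "g = - h"
    have g: "f = [:c, -1:] * g" "g \<noteq> 0"
      using f less.prems by (auto simp: g_def)
    then have "degree f = degree g + 1"
      by (simp add: degree_mult_eq del: mult_pCons_left)
    then obtain k where "coeff_sign_changes g = positive_root_count g + 2 * k"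
      using less.hyps[of g] g by auto
    moreover obtain j where "coeff_sign_changes f = coeff_sign_changes g + 1 + 2 * j"
      using coeff_sign_changes_mult_root_factor[of c g] c g by blast
    moreover have "positive_root_count f = positive_root_count g + 1"
      using positive_root_count_mult_root_factor c g by blast
    ultimately have "coeff_sign_changes f = positive_root_count f + 2 * (k + j)"
      by simp
    then show ?thesis
      by blast
  next
    case False
    then have "{c. c > 0 \<and> poly f c = 0} = {}"
      by blast
    then have "positive_root_count f = 0"
      by (simp only: positive_root_count_def sum.empty)
    then show ?thesis
      using even_coeff_sign_changes[of f] less.prems False by (auto elim: evenE)
  qed
qed

theorem theorem1:
  fixes f :: "real poly"
  assumes "f \<noteq> 0"
  shows "even (int (coeff_sign_changes f) - int (positive_root_count f)) \<and>
    int (coeff_sign_changes f) - int (positive_root_count f) \<ge> 0"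
  using coeff_sign_changes_eq_positive_root_count[OF assms] by auto

end
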